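(* Let $m_0,m_1$ be integers with $m_1\geq m_0\geq 2$, and for $v\in\mathbb{R}$ let $r_v$ be the solution of the $(m_0,m_1)$-ODE with $r_v(0)=0$ and $\dot r_v(0)=v$. For all $t_0,t_1\in(0,\tfrac{\pi}{2})$ and each $\epsilon>0$ there exists an initial velocity $v_0\in\mathbb{R}$ such that $\lvert r_v(t)-\tfrac{\pi}{2}\rvert<\epsilon$ for all $t\in(t_0,t_1)$ and all $v\geq v_0$.
   Context: For positive integers $m_0,m_1$, the $(m_0,m_1)$-ODE for a function $r:(0,\tfrac{\pi}{2})\to\mathbb{R}$ is $$\ddot r(t)=\left((m_1-m_0)\csc 2t-(m_0+m_1)\cot 2t\right)\dot r(t)-m_1\frac{\sin 2r(t)}{2\cos^2 t}+m_0\frac{\sin 2r(t)}{2\sin^2 t}.$$ For every $v\in\mathbb{R}$ there is a unique solution $r_v$ on $[0,\tfrac{\pi}{2})$ with $r_v(0)=0$ and $\dot r_v(0)=v$. *)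

theory Defs
  imports Complex_Main
begin

text \<open>Right-hand side of the ODE at time \<open>t\<close>, position \<open>x\<close> and velocity \<open>y\<close>;
  \<open>1 / sin (2 * t)\<close> is the cosecant of \<open>2 * t\<close>.\<close>

definition ode_rhs :: "nat \<Rightarrow> nat \<Rightarrow> real \<Rightarrow> real \<Rightarrow> real \<Rightarrow> real" where
  "ode_rhs m0 m1 t x y =
     ((real m1 - real m0) * (1 / sin (2 * t)) - (real m0 + real m1) * cot (2 * t)) * y
     - real m1 * (sin (2 * x) / (2 * (cos t)\<^sup>2))
     + real m0 * (sin (2 * x) / (2 * (sin t)\<^sup>2))"

definition solves_ode :: "nat \<Rightarrow> nat \<Rightarrow> (real \<Rightarrow> real) \<Rightarrow> bool" where
  "solves_ode m0 m1 r \<longleftrightarrow>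
     (\<exists>r'. \<forall>t\<in>{0<..<pi/2}.
        (r has_real_derivative r' t) (at t) \<and>
        (r' has_real_derivative ode_rhs m0 m1 t (r t) (r' t)) (at t))"

text \<open>The equation is singular at \<open>0\<close>, so there only the initial position and the one-sided
  initial velocity are prescribed. The values of \<open>r\<close> outside \<open>{0..<pi/2}\<close> are irrelevant.\<close>

definition solves_ivp :: "nat \<Rightarrow> nat \<Rightarrow> real \<Rightarrow> (real \<Rightarrow> real) \<Rightarrow> bool" where
  "solves_ivp m0 m1 v r \<longleftrightarrow>
     solves_ode m0 m1 r \<and> r 0 = 0 \<and> (r has_real_derivative v) (at 0 within {0..<pi/2})"

end

theory Submission imports Defs begin

text \<open>In the variable \<open>x = ln (tan t)\<close> the equation becomes that of a damped pendulum on the whole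
  real line,
  \<open>R'' = - a R' + b sin R cos R\<close>,
  whose coefficients \<open>a\<close> (\<open>damping\<close>) and \<open>b\<close> (\<open>pull\<close>) tend to \<open>m0 - 1 > 0\<close> and \<open>m0\<close> as
  \<open>x \<rightarrow> - \<infinity>\<close>. While \<open>a\<close> and \<open>b\<close> are positive, \<open>R = 0\<close> is the unstable and \<open>R = pi / 2\<close> the stable
  equilibrium. The initial condition says \<open>R x / exp x \<rightarrow> v\<close>, so the pendulum starts at the unstable
  equilibrium and departs from it at time about \<open>- ln v\<close>. A large \<open>v\<close> therefore leaves
  it arbitrarily much time to come to rest at \<open>pi / 2\<close> before a fixed instant \<open>X\<close>, taken so early that
  the coefficients are still almost constant up to then.

  The energy \<open>E = W\<^sup>2 / 2 + b cos\<^sup>2 R / 2\<close>, with \<open>W = R'\<close>, makes this quantitative. It decreases as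
  long as \<open>a\<close> and \<open>b\<close> are positive, because \<open>b\<close> is decreasing too, and it never exceeds its limit
  \<open>m0 / 2\<close> at the start (\<open>E_le_initial\<close>). By the time \<open>ln (c / v)\<close>, for a suitable small \<open>c\<close>, the angle
  has become comparable to \<open>c\<close>, and doing so has cost an amount \<open>k\<close> of energy that does not depend
  on \<open>v\<close> (\<open>state_after_escape\<close>). As long as \<open>b \<ge> m0 - k\<close>, the remaining energy is too small to reach
  \<open>0\<close> or \<open>pi\<close>, so the solution is confined to the well around \<open>pi / 2\<close> and keeps a fixed distance from
  both walls. There a modified energy decreases at a definite rate until \<open>E\<close> is as small as desired
  (\<open>energy_small_for_long_time\<close>).

  After \<open>X\<close> the equilibrium may lose its stability, but only a fixed compact interval of
  times is left, and a Gronwall estimate for \<open>W\<^sup>2 + cos\<^sup>2 R\<close> bounds the growth there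
  (\<open>close_to_half_pi\<close>).\<close>

section \<open>The damped pendulum equation\<close>

definition damping :: "real \<Rightarrow> real \<Rightarrow> real \<Rightarrow> real" where
  "damping m0 m1 x = ((m0 - 1) - (m1 - 1) * exp (2 * x)) / (1 + exp (2 * x))"

definition pull :: "real \<Rightarrow> real \<Rightarrow> real \<Rightarrow> real" where
  "pull m0 m1 x = (m0 - m1 * exp (2 * x)) / (1 + exp (2 * x))"

text \<open>The initial data sit at \<open>x = - \<infinity>\<close>, so differential inequalities are integrated from there.\<close>

lemma nonincreasing_le_limit_at_bot:
  fixes f f' :: "real \<Rightarrow> real"
  assumes d: "\<And>x. x \<le> X \<Longrightarrow> (f has_real_derivative f' x) (at x)"
    and n: "\<And>x. x \<le> X \<Longrightarrow> f' x \<le> 0"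
    and l: "(f \<longlongrightarrow> l) at_bot" and "x \<le> X"
  shows "f x \<le> l"
proof (rule tendsto_lowerbound[OF l])
  have "f x \<le> f y" if "y \<le> x" for y
    by (rule DERIV_nonpos_imp_nonincreasing[OF that])
       (meson d n \<open>x \<le> X\<close> order_trans)
  then show "eventually (\<lambda>y. f x \<le> f y) at_bot"
    using eventually_le_at_bot[of x] by (rule eventually_mono[rotated])
qed simp

lemma limit_at_bot_le_nondecreasing:
  fixes f f' :: "real \<Rightarrow> real"
  assumes d: "\<And>x. x \<le> X \<Longrightarrow> (f has_real_derivative f' x) (at x)"
    and n: "\<And>x. x \<le> X \<Longrightarrow> 0 \<le> f' x"
    and l: "(f \<longlongrightarrow> l) at_bot" and "x \<le> X"
  shows "l \<le> f x"
proof -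
  have "- f x \<le> - l"
    by (rule nonincreasing_le_limit_at_bot[where f' = "\<lambda>x. - f' x" and X = X])
       (use assms in \<open>auto intro!: derivative_eq_intros tendsto_minus\<close>)
  then show ?thesis by simp
qed

lemma arg_minus_sin_cos_le_cube:
  fixes y :: real
  assumes "0 \<le> y"
  shows "y - sin y * cos y \<le> y ^ 3"
proof -
  have "0 ^ 3 - (0 - sin 0 * cos (0::real)) \<le> y ^ 3 - (y - sin y * cos y)"
  proof (rule DERIV_nonneg_imp_nondecreasing[OF assms])
    fix x :: real
    have 1: "((\<lambda>x. x ^ 3 - (x - sin x * cos x)) has_real_derivative
        3 * x\<^sup>2 - (1 - ((cos x)\<^sup>2 - (sin x)\<^sup>2))) (at x)"
      by (auto intro!: derivative_eq_intros simp: power2_eq_square)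
    have "(sin x)\<^sup>2 \<le> x\<^sup>2"
      using abs_sin_x_le_abs_x[of x] by (simp add: abs_le_square_iff)
    then have "3 * x\<^sup>2 - (1 - ((cos x)\<^sup>2 - (sin x)\<^sup>2)) \<ge> 0"
      using sin_cos_squared_add[of x] zero_le_power2[of x] by linarith
    with 1 show "\<exists>y. ((\<lambda>x. x ^ 3 - (x - sin x * cos x)) has_real_derivative y) (at x) \<and> 0 \<le> y"
      by blast
  qed
  then show ?thesis by simp
qed

lemma arg_minus_sin_cos_nonneg:
  fixes y :: real
  assumes "0 \<le> y"
  shows "sin y * cos y \<le> y"
  using sin_x_le_x[of "2 * y"] assms by (simp add: sin_double)

text \<open>The data are the angle \<open>R\<close> and the velocity \<open>W\<close> in logarithmic time. The condition
  \<open>R_asymp\<close> is the initial velocity of the original problem: \<open>exp x\<close> is \<open>tan t\<close>, which is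
  asymptotic to \<open>t\<close> at \<open>0\<close>.\<close>

locale pendulum =
  fixes m0 m1 v :: real and R W :: "real \<Rightarrow> real"
  assumes m0_ge: "2 \<le> m0" and m1_ge: "m0 \<le> m1"
    and R_deriv: "\<And>x. (R has_real_derivative W x) (at x)"
    and W_deriv: "\<And>x. (W has_real_derivative
           - damping m0 m1 x * W x + pull m0 m1 x * (sin (R x) * cos (R x))) (at x)"
    and R_asymp: "((\<lambda>x. R x / exp x) \<longlongrightarrow> v) at_bot"
begin

abbreviation "a \<equiv> damping m0 m1"
abbreviation "b \<equiv> pull m0 m1"

text \<open>The usual energy of a pendulum, normalised to vanish at rest at \<open>pi / 2\<close>.\<close>

definition E :: "real \<Rightarrow> real" where
  "E x = (W x)\<^sup>2 / 2 + b x * (cos (R x))\<^sup>2 / 2"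

lemma b_le: "b x \<le> m0"
proof -
  have "m0 - m1 * exp (2 * x) \<le> m0 * (1 + exp (2 * x))"
    using m0_ge m1_ge by (simp add: algebra_simps add_nonneg_nonneg)
  then show ?thesis by (simp add: pull_def divide_simps add_pos_pos)
qed

lemma a_le: "a x \<le> m0"
proof -
  have "(m1 - 1) * exp (2 * x) \<ge> 0" "m0 * exp (2 * x) \<ge> 0" using m0_ge m1_ge by auto
  then have "(m0 - 1) - (m1 - 1) * exp (2 * x) \<le> m0 * (1 + exp (2 * x))"
    unfolding distrib_left mult_1_right by linarith
  then show ?thesis by (simp add: damping_def divide_simps add_pos_pos)
qed

text \<open>The bound \<open>exp (2 * x) \<le> 1 / (2 * m1)\<close> used throughout delimits the early times, at which
  \<open>a\<close> and \<open>b\<close> are bounded away from zero.\<close>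

lemma a_ge:
  assumes "exp (2 * x) \<le> 1 / (2 * m1)"
  shows "1 / 2 \<le> a x"
proof -
  have "m1 * exp (2 * x) \<le> 1 / 2" using assms m0_ge m1_ge by (simp add: field_simps)
  then have "1 / 2 * (1 + exp (2 * x)) \<le> (m0 - 1) - (m1 - 1) * exp (2 * x)"
    using m0_ge exp_gt_zero[of "2 * x"] unfolding left_diff_distrib distrib_left by linarith
  then show ?thesis
    unfolding damping_def by (subst pos_le_divide_eq) (auto simp: add_pos_pos)
qed

lemma b_ge_one:
  assumes "exp (2 * x) \<le> 1 / (2 * m1)"
  shows "1 \<le> b x"
proof -
  have 1: "m1 * exp (2 * x) \<le> 1 / 2" using assms m0_ge m1_ge by (simp add: field_simps)
  have "exp (2 * x) \<le> m1 * exp (2 * x)"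
    using mult_right_mono[of 1 m1 "exp (2 * x)"] m0_ge m1_ge by simp
  with 1 have "exp (2 * x) \<le> 1 / 2" by (rule order_trans[rotated])
  with 1 have "1 + exp (2 * x) \<le> m0 - m1 * exp (2 * x)"
    using m0_ge by (smt (verit) field_sum_of_halves)
  then show ?thesis
    unfolding pull_def by (subst pos_le_divide_eq) (auto simp: add_pos_pos)
qed

lemma b_ge_near_m0:
  assumes "exp (2 * x) \<le> k / (m0 + m1)" "0 \<le> k"
  shows "m0 - k \<le> b x"
proof -
  have "(m0 + m1) * exp (2 * x) \<le> k" using assms m0_ge m1_ge by (simp add: field_simps)
  moreover have "0 \<le> k * exp (2 * x)" using assms by simp
  ultimately have "(m0 - k) * (1 + exp (2 * x)) \<le> m0 - m1 * exp (2 * x)"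
    by (simp add: algebra_simps)
  then show ?thesis
    unfolding pull_def by (subst pos_le_divide_eq) (auto simp: add_pos_pos)
qed

lemma b_deriv:
  "(b has_real_derivative - 2 * ((m0 + m1) * exp (2 * x) / (1 + exp (2 * x))\<^sup>2)) (at x)"
proof -
  have "1 + exp (2 * x) \<noteq> 0" by (smt (verit) exp_gt_zero)
  then show ?thesis unfolding pull_def[abs_def]
    by (auto intro!: derivative_eq_intros simp: field_simps power2_eq_square)
qed

section \<open>Energy\<close>

lemma E_deriv:
  "(E has_real_derivative
     - a x * (W x)\<^sup>2 - (m0 + m1) * exp (2 * x) / (1 + exp (2 * x))\<^sup>2 * (cos (R x))\<^sup>2) (at x)"
proof -
  define D where "D = (m0 + m1) * exp (2 * x) / (1 + exp (2 * x))\<^sup>2"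
  have "(b has_real_derivative - 2 * D) (at x)"
    using b_deriv[of x] by (simp only: D_def)
  then have "(E has_real_derivative W x * (- a x * W x + b x * (sin (R x) * cos (R x)))
     + (- 2 * D * (cos (R x))\<^sup>2 + b x * (2 * cos (R x) * (- sin (R x) * W x))) / 2) (at x)"
    unfolding E_def[abs_def]
    by - (rule derivative_eq_intros R_deriv W_deriv refl | assumption | simp)+
  also have "W x * (- a x * W x + b x * (sin (R x) * cos (R x)))
     + (- 2 * D * (cos (R x))\<^sup>2 + b x * (2 * cos (R x) * (- sin (R x) * W x))) / 2
     = - a x * (W x)\<^sup>2 - D * (cos (R x))\<^sup>2"
    by (simp add: power2_eq_square field_simps)
  finally show ?thesis by (simp add: D_def)
qed

lemma E_deriv_le:
  "- a x * (W x)\<^sup>2 - (m0 + m1) * exp (2 * x) / (1 + exp (2 * x))\<^sup>2 * (cos (R x))\<^sup>2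
    \<le> - a x * (W x)\<^sup>2"
  using m0_ge m1_ge by simp

lemma small_exp_mono:
  assumes "exp (2 * X) \<le> (K::real)" "x \<le> X"
  shows "exp (2 * x) \<le> K"
  using assms by (smt (verit) exp_le_cancel_iff)

lemma E_decreasing:
  assumes "exp (2 * Y) \<le> 1 / (2 * m1)" "x \<le> y" "y \<le> Y"
  shows "E y \<le> E x"
proof (rule DERIV_nonpos_imp_nonincreasing[OF \<open>x \<le> y\<close>])
  fix z assume "x \<le> z" "z \<le> y"
  then have "1 / 2 \<le> a z" using assms by (intro a_ge small_exp_mono[OF assms(1)]) auto
  then have "- a z * (W z)\<^sup>2 \<le> 0" by simp
  with E_deriv[of z] E_deriv_le[of z]
  show "\<exists>y. (E has_real_derivative y) (at z) \<and> y \<le> 0"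
    by (meson order_trans)
qed

lemma R_tendsto_0: "(R \<longlongrightarrow> 0) at_bot"
proof -
  have "((\<lambda>x. R x / exp x * exp x) \<longlongrightarrow> v * 0) at_bot"
    by (intro tendsto_mult R_asymp exp_at_bot)
  then show ?thesis by simp
qed

text \<open>A larger energy would only grow backwards in time. Since the potential part is at most
  \<open>m0 / 2\<close>, this would keep \<open>\<bar>W\<bar>\<close> above a positive constant for all earlier times, contradicting
  the convergence of \<open>R\<close> at \<open>- \<infinity>\<close>.\<close>

lemma E_le_initial:
  assumes "exp (2 * x) \<le> 1 / (2 * m1)"
  shows "E x \<le> m0 / 2"
proof (rule ccontr)
  assume "\<not> E x \<le> m0 / 2"
  define c where "c = sqrt (2 * E x - m0)"
  have c: "c > 0" "c\<^sup>2 = 2 * E x - m0"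
    using \<open>\<not> E x \<le> m0 / 2\<close> by (auto simp: c_def)
  have W: "c \<le> \<bar>W y\<bar>" if "y \<le> x" for y
  proof -
    have "E x \<le> E y" using E_decreasing[OF assms that] by simp
    moreover have "b y * (cos (R y))\<^sup>2 \<le> m0"
    proof -
      have "1 \<le> b y" by (intro b_ge_one small_exp_mono[OF assms that])
      then have "b y * (cos (R y))\<^sup>2 \<le> b y * 1"
        by (intro mult_left_mono) (auto simp: abs_square_le_1)
      with b_le[of y] show ?thesis by simp
    qed
    ultimately have "c\<^sup>2 \<le> (W y)\<^sup>2" using c by (simp add: E_def)
    then show ?thesis using c(1) by (metis abs_le_square_iff abs_of_pos)
  qed
  have "eventually (\<lambda>y. \<bar>R y\<bar> < c / 2) at_bot"
    using tendstoD[OF R_tendsto_0, of "c / 2"] c by simp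
  then obtain N where N: "\<And>y. y \<le> N \<Longrightarrow> \<bar>R y\<bar> < c / 2"
    by (auto simp: eventually_at_bot_linorder)
  define y where "y = min N x - 1"
  obtain z where z: "y < z" "z < y + 1" "R (y + 1) - R y = (y + 1 - y) * W z"
    using MVT2[of y "y + 1" R W] R_deriv by auto
  have "\<bar>R (y + 1) - R y\<bar> \<ge> c" using z W[of z] by (simp add: y_def)
  moreover have "\<bar>R (y + 1)\<bar> < c / 2" "\<bar>R y\<bar> < c / 2" by (rule N, simp add: y_def)+
  ultimately show False by linarith
qed

lemma W_square_le:
  assumes "exp (2 * x) \<le> 1 / (2 * m1)"
  shows "(W x)\<^sup>2 \<le> m0"
proof -
  have "0 \<le> b x * (cos (R x))\<^sup>2" using b_ge_one[OF assms] by simp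
  then show ?thesis using E_le_initial[OF assms] by (simp add: E_def)
qed

section \<open>Escape from the unstable equilibrium\<close>

text \<open>The integrating factor of the damping term: \<open>mu' = a mu\<close>. In the original variable it is
  \<open>(sin t) powr (m0 - 1) * (cos t) powr (m1 - 1)\<close>.\<close>

definition mu :: "real \<Rightarrow> real" where
  "mu x = exp ((m0 - 1) * x - (m0 + m1 - 2) / 2 * ln (1 + exp (2 * x)))"

lemma mu_pos: "0 < mu x"
  by (simp add: mu_def)

lemma mu_deriv: "(mu has_real_derivative a x * mu x) (at x)"
proof -
  have p: "1 + exp (2 * x) > 0" by (smt (verit) exp_gt_zero)
  have "((\<lambda>x. ln (1 + exp (2 * x))) has_real_derivative 2 * exp (2 * x) / (1 + exp (2 * x))) (at x)"
    using p by (auto intro!: derivative_eq_intros)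
  then have "((\<lambda>x. (m0 + m1 - 2) / 2 * ln (1 + exp (2 * x))) has_real_derivative
      (m0 + m1 - 2) / 2 * (2 * exp (2 * x) / (1 + exp (2 * x)))) (at x)"
    by (rule DERIV_cmult)
  moreover have "((\<lambda>x. (m0 - 1) * x) has_real_derivative (m0 - 1)) (at x)"
    by (auto intro!: derivative_eq_intros)
  ultimately have "(mu has_real_derivative
     mu x * ((m0 - 1) - (m0 + m1 - 2) / 2 * (2 * exp (2 * x) / (1 + exp (2 * x))))) (at x)"
    unfolding mu_def by (intro DERIV_fun_exp DERIV_diff)
  also have "(m0 - 1) - (m0 + m1 - 2) / 2 * (2 * exp (2 * x) / (1 + exp (2 * x))) = a x"
  proof -
    define d where "d = 1 + exp (2 * x)"
    have "d \<noteq> 0" "exp (2 * x) = d - 1" using p by (auto simp: d_def)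
    then show ?thesis unfolding damping_def \<open>exp (2 * x) = d - 1\<close>
      by (simp add: field_simps)
  qed
  finally show ?thesis by (simp add: mult.commute)
qed

lemma mu_le:
  assumes "x \<le> 0"
  shows "mu x \<le> 1"
proof -
  have "(m0 - 1) * x \<le> 0" using m0_ge assms by (simp add: mult_nonneg_nonpos)
  moreover have "(m0 + m1 - 2) / 2 * ln (1 + exp (2 * x)) \<ge> 0"
    using m0_ge m1_ge by (intro mult_nonneg_nonneg) auto
  ultimately have "(m0 - 1) * x - (m0 + m1 - 2) / 2 * ln (1 + exp (2 * x)) \<le> 0" by linarith
  then show ?thesis unfolding mu_def by simp
qed

text \<open>The linearised equation with the limit coefficients has the solution \<open>exp\<close>, and \<open>J\<close> is the weighted
  Wronskian of \<open>exp\<close> and \<open>R\<close>. The quotient \<open>R / exp\<close> has derivative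
  \<open>J / (mu * (exp x)\<^sup>2)\<close>, so bounds on \<open>J\<close> control how far \<open>R\<close> deviates from \<open>v * exp x\<close>.\<close>

definition J :: "real \<Rightarrow> real" where
  "J x = mu x * exp x * (W x - R x)"

lemma J_deriv:
  "(J has_real_derivative - (mu x * exp x *
     (b x * (R x - sin (R x) * cos (R x)) + 2 * exp (2 * x) / (1 + exp (2 * x)) * R x))) (at x)"
proof -
  have p: "1 + exp (2 * x) \<noteq> 0" by (smt (verit) exp_gt_zero)
  have ab: "1 + a x = b x + 2 * exp (2 * x) / (1 + exp (2 * x))"
  proof -
    define d where "d = 1 + exp (2 * x)"
    have "d \<noteq> 0" "exp (2 * x) = d - 1" using p by (auto simp: d_def)
    then show ?thesis unfolding damping_def pull_def \<open>exp (2 * x) = d - 1\<close>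
      by (simp add: field_simps)
  qed
  have "(J has_real_derivative
     mu x * exp x * (- a x * W x + b x * (sin (R x) * cos (R x)) - W x)
     + (a x * mu x * exp x + mu x * exp x) * (W x - R x)) (at x)"
    unfolding J_def[abs_def]
    by (rule derivative_eq_intros R_deriv W_deriv mu_deriv refl | simp)+
  also have "mu x * exp x * (- a x * W x + b x * (sin (R x) * cos (R x)) - W x)
     + (a x * mu x * exp x + mu x * exp x) * (W x - R x)
     = - (mu x * exp x * ((1 + a x) * R x - b x * (sin (R x) * cos (R x))))"
    by (simp add: algebra_simps)
  also have "\<dots> = - (mu x * exp x *
     (b x * (R x - sin (R x) * cos (R x)) + 2 * exp (2 * x) / (1 + exp (2 * x)) * R x))"
    unfolding ab by (simp add: algebra_simps)
  finally show ?thesis .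
qed

lemma eventually_small_exp: "eventually (\<lambda>x. exp (2 * x) \<le> 1 / (2 * m1)) at_bot"
proof -
  have "exp (2 * x) \<le> 1 / (2 * m1)" if "x \<le> ln (1 / (2 * m1)) / 2" for x
  proof -
    have "exp (2 * x) \<le> exp (ln (1 / (2 * m1)))" using that by simp
    then show ?thesis using m0_ge m1_ge by simp
  qed
  then show ?thesis unfolding eventually_at_bot_linorder by blast
qed

lemma J_tendsto_0: "(J \<longlongrightarrow> 0) at_bot"
proof (rule tendsto_0_le[OF exp_at_bot])
  have "eventually (\<lambda>y. \<bar>R y\<bar> < 1) at_bot"
    using tendstoD[OF R_tendsto_0, of 1] by simp
  with eventually_small_exp eventually_le_at_bot[of 0]
  show "eventually (\<lambda>x. norm (J x) \<le> norm (exp x) * (m0 + 1)) at_bot"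
  proof eventually_elim
    case (elim x)
    have "m0 \<le> m0\<^sup>2" using m0_ge by (simp add: power2_eq_square)
    then have "(W x)\<^sup>2 \<le> m0\<^sup>2" using W_square_le[OF elim(1)] by simp
    then have "\<bar>W x\<bar> \<le> m0"
      using m0_ge by (simp add: abs_le_square_iff[symmetric])
    then have "\<bar>W x - R x\<bar> \<le> m0 + 1" using elim by linarith
    then have "mu x * \<bar>W x - R x\<bar> \<le> 1 * (m0 + 1)"
      using mu_le[of x] mu_pos[of x] elim by (intro mult_mono) auto
    then show ?case
      using mu_pos[of x] by (simp add: J_def abs_mult mult_ac)
  qed
qed

lemma R_div_exp_deriv:
  "((\<lambda>x. R x / exp x) has_real_derivative J x / (mu x * exp x * exp x)) (at x)"
proof -
  have "((\<lambda>x. R x / exp x) has_real_derivative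
      (W x * exp x - R x * exp x) / (exp x * exp x)) (at x)"
    by (intro DERIV_divide R_deriv DERIV_exp) simp
  also have "(W x * exp x - R x * exp x) / (exp x * exp x) = J x / (mu x * exp x * exp x)"
    using mu_pos[of x] by (simp add: J_def field_simps)
  finally show ?thesis .
qed

text \<open>The function \<open>exp\<close> would be a solution under the linear force \<open>(1 + a) R\<close>. For \<open>R \<ge> 0\<close> the
  actual force \<open>b sin R cos R\<close> is at most \<open>b R \<le> (1 + a) R\<close>, so \<open>J\<close> decreases from its limit \<open>0\<close>.\<close>

lemma J_nonpos:
  assumes Y: "exp (2 * Y) \<le> 1 / (2 * m1)" and pos: "\<And>x. x \<le> Y \<Longrightarrow> 0 \<le> R x"
    and "x \<le> Y"
  shows "J x \<le> 0"
proof (rule nonincreasing_le_limit_at_bot[OF J_deriv _ J_tendsto_0 \<open>x \<le> Y\<close>])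
  fix x assume x: "x \<le> Y"
  have "1 \<le> b x" by (intro b_ge_one small_exp_mono[OF Y x])
  then have "0 \<le> b x * (R x - sin (R x) * cos (R x))"
    using arg_minus_sin_cos_nonneg[OF pos[OF x]] by simp
  moreover have "0 \<le> 2 * exp (2 * x) / (1 + exp (2 * x)) * R x"
    using pos[OF x] by (simp add: add_nonneg_nonneg)
  ultimately show "- (mu x * exp x *
     (b x * (R x - sin (R x) * cos (R x)) + 2 * exp (2 * x) / (1 + exp (2 * x)) * R x)) \<le> 0"
    using mu_pos[of x] by simp
qed

lemma R_le:
  assumes "exp (2 * Y) \<le> 1 / (2 * m1)" and "\<And>x. x \<le> Y \<Longrightarrow> 0 \<le> R x" and "x \<le> Y"
  shows "R x \<le> v * exp x"
proof -
  have "R x / exp x \<le> v"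
    using J_nonpos[OF assms(1,2)] mu_pos
    by (intro nonincreasing_le_limit_at_bot[OF R_div_exp_deriv _ R_asymp \<open>x \<le> Y\<close>])
       (auto simp: divide_nonpos_pos)
  then show ?thesis by (simp add: field_simps)
qed

text \<open>The nonlinear defect \<open>R - sin R cos R\<close> is at most \<open>R ^ 3 \<le> (v * exp x) ^ 3\<close> and the defect of the
  coefficients is of order \<open>exp (2 * x) * R\<close>, which \<open>v \<ge> 1\<close> allows to absorb in the same bound. The
  comparison function \<open>mu * exp (4 * x)\<close> grows at rate at least \<open>4\<close>, hence the constant.\<close>

lemma J_ge:
  assumes Y: "exp (2 * Y) \<le> 1 / (2 * m1)" and pos: "\<And>x. x \<le> Y \<Longrightarrow> 0 \<le> R x"
    and v: "1 \<le> v" and "x \<le> Y"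
  shows "- ((m0 + 2) / 4 * v ^ 3 * (mu x * exp (4 * x))) \<le> J x"
proof -
  define C where "C = (m0 + 2) / 4 * v ^ 3"
  have C: "0 \<le> C" using m0_ge v by (simp add: C_def)
  have lim: "((\<lambda>x. J x + C * (mu x * exp (4 * x))) \<longlongrightarrow> 0 + 0) at_bot"
  proof (intro tendsto_add J_tendsto_0 tendsto_0_le[OF exp_at_bot])
    show "eventually (\<lambda>x. norm (C * (mu x * exp (4 * x))) \<le> norm (exp x) * C) at_bot"
      using eventually_le_at_bot[of 0]
    proof eventually_elim
      case (elim x)
      have "mu x * exp (4 * x) \<le> 1 * exp x"
        using mu_le[OF elim] mu_pos[of x] elim by (intro mult_mono) auto
      then show ?case using C mu_pos[of x] by (simp add: abs_mult mult_left_mono mult.commute)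
    qed
  qed
  have "0 \<le> J x + C * (mu x * exp (4 * x))"
  proof (rule limit_at_bot_le_nondecreasing[OF _ _ lim[simplified] \<open>x \<le> Y\<close>])
    fix x assume x: "x \<le> Y"
    define G where
      "G = b x * (R x - sin (R x) * cos (R x)) + 2 * exp (2 * x) / (1 + exp (2 * x)) * R x"
    have "(J has_real_derivative - (mu x * exp x * G)) (at x)"
      using J_deriv[of x] by (simp add: G_def)
    then show "((\<lambda>x. J x + C * (mu x * exp (4 * x))) has_real_derivative
        mu x * (C * (4 + a x) * exp (4 * x) - exp x * G)) (at x)"
      by - ((rule derivative_eq_intros mu_deriv refl | assumption | simp)+,
          simp add: algebra_simps)
    have R: "0 \<le> R x" "R x \<le> v * exp x" using pos[OF x] R_le[OF Y pos x] by auto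
    have "R x - sin (R x) * cos (R x) \<le> (v * exp x) ^ 3"
      using arg_minus_sin_cos_le_cube[OF R(1)] power_mono[OF R(2,1), of 3] by simp
    then have 1: "b x * (R x - sin (R x) * cos (R x)) \<le> m0 * (v * exp x) ^ 3"
      using b_le[of x] m0_ge arg_minus_sin_cos_nonneg[OF R(1)] by (intro mult_mono) auto
    have "v * exp (3 * x) \<le> v ^ 3 * exp (3 * x)"
      using v by (intro mult_right_mono self_le_power) auto
    moreover have "2 * exp (2 * x) / (1 + exp (2 * x)) * R x \<le> (2 * exp (2 * x)) * (v * exp x)"
      (is "?L \<le> _")
    proof (rule mult_mono)
      have "2 * exp (2 * x) * 1 \<le> 2 * exp (2 * x) * (1 + exp (2 * x))"
        by (intro mult_left_mono) auto
      then show "2 * exp (2 * x) / (1 + exp (2 * x)) \<le> 2 * exp (2 * x)"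
        by (subst pos_divide_le_eq) (auto simp: add_pos_pos)
    qed (use R in auto)
    moreover have e: "(exp x) ^ 3 = exp (3 * x)" "exp (2 * x) * exp x = exp (3 * x)"
      by (simp_all flip: exp_of_nat_mult exp_add)
    moreover have "2 * exp (2 * x) * (v * exp x) = 2 * (v * exp (3 * x))"
      unfolding e(2)[symmetric] by (simp add: mult_ac)
    ultimately have "?L \<le> 2 * (v ^ 3 * exp (3 * x))" by linarith
    then have "G \<le> m0 * (v ^ 3 * exp (3 * x)) + 2 * (v ^ 3 * exp (3 * x))"
      using 1 unfolding G_def power_mult_distrib e(1) by linarith
    then have "exp x * G \<le> exp x * (4 * C * exp (3 * x))"
      by (intro mult_left_mono) (auto simp: C_def algebra_simps)
    also have "\<dots> = C * 4 * exp (4 * x)"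
      by (simp add: mult_ac flip: exp_add)
    also have "\<dots> \<le> C * (4 + a x) * exp (4 * x)"
      using C a_ge[OF small_exp_mono[OF Y x]] by (intro mult_right_mono mult_left_mono) auto
    finally show "0 \<le> mu x * (C * (4 + a x) * exp (4 * x) - exp x * G)"
      using mu_pos[of x] by simp
  qed
  then show ?thesis by (simp add: C_def)
qed

lemma R_ge:
  assumes Y: "exp (2 * Y) \<le> 1 / (2 * m1)" and pos: "\<And>x. x \<le> Y \<Longrightarrow> 0 \<le> R x"
    and v: "1 \<le> v" and "x \<le> Y"
  shows "(v - (m0 + 2) / 8 * v ^ 3 * exp (2 * x)) * exp x \<le> R x"
proof -
  define C where "C = (m0 + 2) / 8 * v ^ 3"
  have "((\<lambda>x. exp x * exp x) \<longlongrightarrow> (0::real) * 0) at_bot"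
    by (intro tendsto_mult exp_at_bot)
  then have e2: "((\<lambda>x. exp (2 * x)) \<longlongrightarrow> (0::real)) at_bot"
    by (simp flip: exp_add)
  have "((\<lambda>x. R x / exp x + C * exp (2 * x)) \<longlongrightarrow> v + C * 0) at_bot"
    by (intro tendsto_intros R_asymp e2)
  then have lim: "((\<lambda>x. R x / exp x + C * exp (2 * x)) \<longlongrightarrow> v) at_bot"
    by simp
  have "v \<le> R x / exp x + C * exp (2 * x)"
  proof (rule limit_at_bot_le_nondecreasing[OF _ _ lim \<open>x \<le> Y\<close>])
    fix x assume x: "x \<le> Y"
    show "((\<lambda>x. R x / exp x + C * exp (2 * x)) has_real_derivative
        J x / (mu x * exp x * exp x) + C * (2 * exp (2 * x))) (at x)"
      by (rule derivative_eq_intros R_div_exp_deriv refl | simp)+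
    have e: "exp x * exp x * exp (2 * x) = exp (4 * x)" by (simp flip: exp_add)
    have "- (C * (2 * exp (2 * x)) * (mu x * exp x * exp x)) \<le> J x"
      using J_ge[OF Y pos v x] unfolding C_def e[symmetric] by (simp add: mult_ac)
    then have "- (C * (2 * exp (2 * x))) \<le> J x / (mu x * exp x * exp x)"
      using mu_pos[of x] by (subst pos_le_divide_eq) auto
    then show "0 \<le> J x / (mu x * exp x * exp x) + C * (2 * exp (2 * x))" by simp
  qed
  then have "(v - C * exp (2 * x)) * exp x \<le> R x / exp x * exp x"
    by (intro mult_right_mono) auto
  then show ?thesis by (simp add: C_def)
qed

text \<open>For \<open>v * exp Y \<le> 1 / (m0 + 2)\<close> the cubic correction in \<open>R_ge\<close> is at most half of the linear term.\<close>

lemma R_ge_half: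
  assumes Y: "exp (2 * Y) \<le> 1 / (2 * m1)" and pos: "\<And>x. x \<le> Y \<Longrightarrow> 0 \<le> R x"
    and v: "1 \<le> v" and c: "v * exp Y \<le> 1 / (m0 + 2)"
  shows "v / 2 * exp Y \<le> R Y"
proof -
  have e: "exp (2 * Y) = exp Y * exp Y" by (simp flip: exp_add)
  have "(m0 + 2) * (v * exp Y) * (v * exp Y) \<le> 1 * (v * exp Y)"
    using c m0_ge v by (intro mult_right_mono) (auto simp: field_simps)
  also have "\<dots> \<le> 1"
  proof -
    have "1 / (m0 + 2) \<le> 1" using m0_ge by simp
    with c show ?thesis by simp
  qed
  finally have "v * ((m0 + 2) * (v * exp Y) * (v * exp Y)) \<le> v * 1"
    using v by (intro mult_left_mono) auto
  also have "v * ((m0 + 2) * (v * exp Y) * (v * exp Y)) = 8 * ((m0 + 2) / 8 * v ^ 3 * exp (2 * Y))"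
    unfolding e by (simp add: power3_eq_cube)
  finally have "(m0 + 2) / 8 * v ^ 3 * exp (2 * Y) \<le> v / 2"
    using v by simp
  then have "v / 2 * exp Y \<le> (v - (m0 + 2) / 8 * v ^ 3 * exp (2 * Y)) * exp Y"
    by (intro mult_right_mono) auto
  also have "\<dots> \<le> R Y" by (rule R_ge[OF Y pos v order_refl])
  finally show ?thesis .
qed

lemma continuous_R: "continuous_on S R"
  by (rule DERIV_continuous_on[OF has_field_derivative_at_within[OF R_deriv]])

text \<open>The preceding estimates presuppose \<open>0 \<le> R\<close>. At a first zero of \<open>R\<close> they would hold up to
  that point, and the lower bound would make \<open>R\<close> positive there.\<close>

lemma R_pos:
  assumes Y: "exp (2 * Y) \<le> 1 / (2 * m1)" and v: "1 \<le> v"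
    and c: "v * exp Y \<le> 1 / (m0 + 2)" and "x \<le> Y"
  shows "0 < R x"
proof (rule ccontr)
  assume "\<not> 0 < R x"
  have "eventually (\<lambda>x. 0 < R x / exp x) at_bot"
    using v by (intro order_tendstoD(1)[OF R_asymp]) auto
  then obtain N where N: "\<And>x. x \<le> N \<Longrightarrow> 0 < R x"
    by (auto simp: eventually_at_bot_linorder zero_less_divide_iff)
  define S where "S = {N..x} \<inter> {y. R y \<le> 0}"
  have "x \<in> S" using N[of x] \<open>\<not> 0 < R x\<close> by (force simp: S_def)
  have "closed {y. R y \<le> 0}"
    by (intro closed_Collect_le continuous_R continuous_on_const)
  then have "compact S" unfolding S_def by (intro compact_Int_closed compact_Icc)
  then obtain y where y: "y \<in> S" "\<And>z. z \<in> S \<Longrightarrow> y \<le> z"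
    using compact_attains_inf[of S] \<open>x \<in> S\<close> by auto
  have before: "0 < R z" if "z < y" for z
    using N[of z] y(2)[of z] y(1) that by (force simp: S_def)
  have "R y \<ge> 0"
  proof (rule tendsto_lowerbound)
    show "(R \<longlongrightarrow> R y) (at_left y)"
      using DERIV_isCont[OF R_deriv[of y]] by (simp add: isCont_def filterlim_at_split)
    show "eventually (\<lambda>z. 0 \<le> R z) (at_left y)"
      using before by (auto simp: eventually_at_filter less_imp_le)
  qed simp
  have "y \<le> Y" using y(1) \<open>x \<le> Y\<close> by (simp add: S_def)
  have "v * exp y \<le> v * exp Y" using \<open>y \<le> Y\<close> v by simp
  then have "v / 2 * exp y \<le> R y"
  proof (intro R_ge_half small_exp_mono[OF Y \<open>y \<le> Y\<close>] v)
    show "0 \<le> R z" if "z \<le> y" for z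
      using before[of z] \<open>R y \<ge> 0\<close> that by (cases "z = y") auto
  qed (use c in auto)
  moreover have "R y \<le> 0" using y(1) by (simp add: S_def)
  moreover have "0 < v / 2 * exp y" using v by simp
  ultimately show False by linarith
qed

text \<open>Between \<open>x1 - 2\<close> and \<open>x1\<close> the angle rises from at most \<open>c / 4\<close> to at least \<open>c / 2\<close>.
  Since \<open>E' \<le> - W\<^sup>2 / 2\<close>, covering a distance \<open>c / 4\<close> within time \<open>2\<close> dissipates energy, by the
  Cauchy--Schwarz inequality at least \<open>(c / 4)\<^sup>2 / 4\<close>.\<close>

lemma state_after_escape:
  assumes X: "exp (2 * X) \<le> 1 / (2 * m1)" and "1 \<le> v"
    and c: "c = 1 / (m0 + 2)" and x1: "v * exp x1 = c" and "x1 \<le> X"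
  shows "0 < R x1" "R x1 \<le> c" "E x1 \<le> m0 / 2 - c\<^sup>2 / 64"
proof -
  have c0: "0 < c" using m0_ge c by simp
  note X1 = small_exp_mono[OF X \<open>x1 \<le> X\<close>]
  have pos: "0 < R x" if "x \<le> x1" for x
    by (rule R_pos[OF X1 \<open>1 \<le> v\<close> _ that]) (simp add: x1 c)
  then show "0 < R x1" by simp
  have up: "R x \<le> v * exp x" if "x \<le> x1" for x
    by (rule R_le[OF X1 _ that]) (simp add: pos less_imp_le)
  from up[of x1] show "R x1 \<le> c" by (simp add: x1)
  have late: "c / 2 \<le> R x1"
    using R_ge_half[OF X1 _ \<open>1 \<le> v\<close>] pos by (simp add: x1 c less_imp_le)
  have "exp 1 * exp 1 \<ge> 2 * (2::real)"
    using exp_ge_add_one_self[of 1] by (intro mult_mono) auto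
  then have "exp 2 \<ge> (4::real)" by (simp flip: exp_add)
  then have "c / exp 2 \<le> c / 4" using c0 by (intro divide_left_mono) auto
  moreover have "v * exp (x1 - 2) = c / exp 2" by (simp add: exp_diff flip: x1)
  ultimately have early: "R (x1 - 2) \<le> c / 4" using up[of "x1 - 2"] by linarith
  \<comment> \<open>The speed that covers the distance \<open>c / 4\<close> in time \<open>2\<close>. Replacing \<open>W\<^sup>2\<close> by its tangent
      \<open>2 * l * W - l\<^sup>2\<close> at this speed turns the Cauchy--Schwarz inequality into the monotonicity of a function.\<close>
  define l where "l = c / 8"
  have "E x1 + (l * R x1 - l\<^sup>2 / 2 * x1) \<le> E (x1 - 2) + (l * R (x1 - 2) - l\<^sup>2 / 2 * (x1 - 2))"
  proof (rule DERIV_nonpos_imp_nonincreasing[where f = "\<lambda>x. E x + (l * R x - l\<^sup>2 / 2 * x)"])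
    fix x assume "x1 - 2 \<le> x" "x \<le> x1"
    then have a: "1 / 2 \<le> a x" by (intro a_ge small_exp_mono[OF X1])
    obtain D where D: "(E has_real_derivative D) (at x)" "D \<le> - a x * (W x)\<^sup>2"
      using E_deriv E_deriv_le by blast
    have "1 / 2 * (W x)\<^sup>2 \<le> a x * (W x)\<^sup>2" using a by (intro mult_right_mono) auto
    moreover have "0 \<le> (W x - l)\<^sup>2" by simp
    ultimately have "D + (l * W x - l\<^sup>2 / 2) \<le> 0"
      using D(2) by (simp add: power2_diff algebra_simps)
    moreover have "((\<lambda>x. E x + (l * R x - l\<^sup>2 / 2 * x)) has_real_derivative
        D + (l * W x - l\<^sup>2 / 2)) (at x)"
      by (rule derivative_eq_intros D(1) R_deriv refl | simp)+
    ultimately show "\<exists>y. ((\<lambda>x. E x + (l * R x - l\<^sup>2 / 2 * x)) has_real_derivative y) (at x) \<and> y \<le> 0"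
      by blast
  qed simp
  moreover have "l * (c / 4) \<le> l * (R x1 - R (x1 - 2))"
    using early late c0 by (intro mult_left_mono) (auto simp: l_def)
  moreover have "E (x1 - 2) \<le> m0 / 2" by (intro E_le_initial small_exp_mono[OF X1]) simp
  ultimately show "E x1 \<le> m0 / 2 - c\<^sup>2 / 64"
    by (simp add: l_def algebra_simps power2_eq_square add_divide_distrib diff_divide_distrib)
qed

section \<open>Relaxation in the well\<close>

text \<open>To leave the interval between \<open>d\<close> and \<open>pi - d\<close>, the angle has to pass an end point, where
  \<open>cos\<^sup>2 R = cos\<^sup>2 d\<close>. This is used both with \<open>d = 0\<close>, for confinement to the well, and with
  \<open>d = pi / 2 - \<epsilon>\<close>, for the final closeness.\<close>

lemma well_confinement:
  assumes start: "0 < R p" "R p < pi" and stay: "\<And>y. p \<le> y \<Longrightarrow> y \<le> q \<Longrightarrow> (cos (R y))\<^sup>2 < (cos d)\<^sup>2"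
    and d: "0 \<le> d" "d < pi / 2" and x: "p \<le> x" "x \<le> q"
  shows "d < R x" "R x < pi - d"
proof -
  have sep: "R y \<noteq> d" "R y \<noteq> pi - d" if "p \<le> y" "y \<le> q" for y
    using stay[OF that] by auto
  have cosd: "0 < cos d" using d by (intro cos_gt_zero_pi) auto
  have cp: "\<bar>cos (R p)\<bar> < cos d"
    using stay[of p] x cosd abs_le_square_iff[of "cos d" "cos (R p)"] by linarith
  have p: "d < R p" "R p < pi - d"
  proof -
    have "cos (R p) < cos d" using cp by simp
    then show "d < R p" using start d by (subst (asm) cos_mono_less_eq) auto
    have "cos (pi - d) < cos (R p)" using cp by simp
    then show "R p < pi - d" using start d by (subst (asm) cos_mono_less_eq) auto
  qed
  show "d < R x"
  proof (rule ccontr)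
    assume "\<not> d < R x"
    then obtain y where "p \<le> y" "y \<le> x" "R y = d"
      using IVT2'[of R x d p] p x continuous_R by auto
    with sep x show False by auto
  qed
  show "R x < pi - d"
  proof (rule ccontr)
    assume "\<not> R x < pi - d"
    then obtain y where "p \<le> y" "y \<le> x" "R y = pi - d"
      using IVT'[of R p "pi - d" x] p x continuous_R by auto
    with sep x show False by auto
  qed
qed

text \<open>The dissipation \<open>a W\<^sup>2\<close> of \<open>E\<close> vanishes whenever the pendulum turns, however large its energy.
  Subtracting a small multiple of \<open>W * sin R * cos R\<close> adds dissipation proportional to
  \<open>(sin R * cos R)\<^sup>2\<close>, which is positive everywhere except at the equilibria. The factor is small enough for the cross
  terms to be absorbed by the damping \<open>a \<ge> 1 / 2\<close>.\<close>

definition H :: "real \<Rightarrow> real" where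
  "H x = E x - 1 / (4 + 2 * m0\<^sup>2) * (W x * (sin (R x) * cos (R x)))"

lemma sin_cos_R_deriv:
  "((\<lambda>x. sin (R x) * cos (R x)) has_real_derivative ((cos (R x))\<^sup>2 - (sin (R x))\<^sup>2) * W x) (at x)"
  by (auto intro!: derivative_eq_intros R_deriv[THEN DERIV_cong] simp: power2_eq_square algebra_simps)

lemma sin_cos_square_le_1: "(sin t * cos t)\<^sup>2 \<le> (1::real)"
  unfolding power_mult_distrib using mult_mono[of "(sin t)\<^sup>2" 1 "(cos t)\<^sup>2" 1]
  by (simp add: abs_square_le_1)

lemma abs_H_le:
  assumes "exp (2 * x) \<le> 1 / (2 * m1)"
  shows "\<bar>H x\<bar> \<le> m0"
proof -
  define y where "y = sin (R x) * cos (R x)"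
  have "0 \<le> (\<bar>W x\<bar> - \<bar>y\<bar>)\<^sup>2" by simp
  then have "2 * \<bar>W x * y\<bar> \<le> (W x)\<^sup>2 + y\<^sup>2" by (simp add: power2_diff abs_mult)
  moreover have "y\<^sup>2 \<le> 1" by (simp add: y_def sin_cos_square_le_1)
  ultimately have Wy: "\<bar>W x * y\<bar> \<le> 2 * m0" using W_square_le[OF assms] m0_ge by linarith
  have "1 / (4 + 2 * m0\<^sup>2) * \<bar>W x * y\<bar> \<le> 1 / 4 * (2 * m0)"
    using Wy by (intro mult_mono divide_left_mono) (auto simp: add_pos_nonneg)
  then have 1: "\<bar>1 / (4 + 2 * m0\<^sup>2) * (W x * y)\<bar> \<le> m0 / 2"
    unfolding abs_mult[of "1 / (4 + 2 * m0\<^sup>2)"] by simp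
  have "0 \<le> b x * (cos (R x))\<^sup>2" using b_ge_one[OF assms] by simp
  then have "0 \<le> E x" by (simp add: E_def)
  then show ?thesis using 1 E_le_initial[OF assms] unfolding H_def y_def[symmetric] by linarith
qed

text \<open>For \<open>k > 0\<close> the bound \<open>k \<le> sin\<^sup>2 R\<close> excludes the unstable equilibria, so that the dissipation controls
  \<open>cos\<^sup>2 R\<close>, and hence the whole energy.\<close>

lemma H_deriv_le:
  assumes x: "exp (2 * x) \<le> 1 / (2 * m1)" and s: "k \<le> (sin (R x))\<^sup>2" "0 \<le> k" "k \<le> 1"
    and e: "\<delta> \<le> E x"
  shows "\<exists>D. (H has_real_derivative D) (at x) \<and> D \<le> - (k / (4 + 2 * m0\<^sup>2) / m0 * \<delta>)"
proof -
  define \<theta> where "\<theta> = 1 / (4 + 2 * m0\<^sup>2)"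
  have "4 + 2 * m0\<^sup>2 > 0" using m0_ge by (intro add_pos_nonneg) auto
  then have th: "0 < \<theta>" "\<theta> \<le> 1 / 4" "\<theta> + \<theta> * m0\<^sup>2 / 2 \<le> 1 / 4"
    by (auto simp: \<theta>_def field_simps)
  define w y C where "w = W x" and "y = sin (R x) * cos (R x)"
    and "C = (cos (R x))\<^sup>2 - (sin (R x))\<^sup>2"
  obtain D where D: "(E has_real_derivative D) (at x)" "D \<le> - a x * w\<^sup>2"
    using E_deriv E_deriv_le unfolding w_def by blast
  have a: "1 / 2 \<le> a x" "a x \<le> m0" using a_ge[OF x] a_le by auto
  have b: "1 \<le> b x" "b x \<le> m0" using b_ge_one[OF x] b_le by auto
  have "(H has_real_derivative D - \<theta> * (w * (C * w) + (- a x * w + b x * y) * y)) (at x)"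
    unfolding H_def[abs_def] \<theta>_def[symmetric] w_def y_def C_def
    by (rule derivative_eq_intros D(1) W_deriv sin_cos_R_deriv refl | simp)+
  moreover have "D - \<theta> * (w * (C * w) + (- a x * w + b x * y) * y) \<le> - (\<theta> * k / m0 * \<delta>)"
  proof -
    have "- C \<le> 1" unfolding C_def using abs_square_le_1[of "sin (R x)"]
      by (smt (verit) abs_sin_le_one zero_le_power2)
    then have "- C * w\<^sup>2 \<le> 1 * w\<^sup>2" by (intro mult_right_mono) auto
    moreover have "a x * w * y \<le> (m0\<^sup>2 * w\<^sup>2 + y\<^sup>2) / 2"
    proof -
      have "0 \<le> (a x * w - y)\<^sup>2" by simp
      moreover have "(a x)\<^sup>2 * w\<^sup>2 \<le> m0\<^sup>2 * w\<^sup>2"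
        using a by (intro mult_right_mono power_mono) auto
      ultimately show ?thesis by (simp add: power2_diff power_mult_distrib)
    qed
    moreover have "1 * y\<^sup>2 \<le> b x * y\<^sup>2" using b by (intro mult_right_mono) auto
    ultimately have "- (w * (C * w) + (- a x * w + b x * y) * y) \<le> w\<^sup>2 + m0\<^sup>2 * w\<^sup>2 / 2 - y\<^sup>2 / 2"
      by (simp add: power2_eq_square algebra_simps)
    then have "\<theta> * - (w * (C * w) + (- a x * w + b x * y) * y)
        \<le> \<theta> * (w\<^sup>2 + m0\<^sup>2 * w\<^sup>2 / 2 - y\<^sup>2 / 2)"
      using th by (intro mult_left_mono) auto
    also have "\<dots> = (\<theta> + \<theta> * m0\<^sup>2 / 2) * w\<^sup>2 - \<theta> * y\<^sup>2 / 2" by (simp add: algebra_simps)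
    also have "\<dots> \<le> 1 / 4 * w\<^sup>2 - \<theta> * y\<^sup>2 / 2"
      using th by (intro diff_right_mono mult_right_mono) auto
    finally have 1: "\<theta> * - (w * (C * w) + (- a x * w + b x * y) * y) \<le> 1 / 4 * w\<^sup>2 - \<theta> * y\<^sup>2 / 2" .
    have 2: "1 / 2 * w\<^sup>2 \<le> a x * w\<^sup>2" using a by (intro mult_right_mono) auto
    have "k * (cos (R x))\<^sup>2 \<le> (sin (R x))\<^sup>2 * (cos (R x))\<^sup>2"
      using s by (intro mult_right_mono) auto
    then have "\<theta> * (k * (cos (R x))\<^sup>2) \<le> \<theta> * y\<^sup>2"
      using th by (intro mult_left_mono) (auto simp: y_def power_mult_distrib)
    with 1 2 D(2) have
      3: "D - \<theta> * (w * (C * w) + (- a x * w + b x * y) * y) \<le> - (w\<^sup>2 / 4 + \<theta> * k * (cos (R x))\<^sup>2 / 2)"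
      unfolding mult_minus_right mult_minus_left mult.assoc[of \<theta> k] by linarith
    define g where "g = \<theta> * k / m0"
    have g: "0 \<le> g" "g * m0 = \<theta> * k" using th s m0_ge by (auto simp: g_def)
    have "\<theta> * k \<le> 1 / 4 * 1" using th s by (intro mult_mono) auto
    moreover have "g * 1 \<le> g * m0" using g m0_ge by (intro mult_left_mono) auto
    ultimately have "g \<le> 1 / 4" using g by linarith
    have "b x * (cos (R x))\<^sup>2 \<le> m0 * (cos (R x))\<^sup>2" using b by (intro mult_right_mono) auto
    then have "\<delta> \<le> w\<^sup>2 / 2 + m0 * (cos (R x))\<^sup>2 / 2" using e by (simp add: E_def w_def)
    then have "g * \<delta> \<le> g * (w\<^sup>2 / 2 + m0 * (cos (R x))\<^sup>2 / 2)"
      using g by (intro mult_left_mono) auto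
    also have "\<dots> = g * w\<^sup>2 / 2 + g * m0 * (cos (R x))\<^sup>2 / 2" by (simp add: algebra_simps)
    also have "g * w\<^sup>2 \<le> 1 / 4 * w\<^sup>2" using \<open>g \<le> 1 / 4\<close> by (intro mult_right_mono) auto
    finally have "g * \<delta> \<le> w\<^sup>2 / 4 + \<theta> * k * (cos (R x))\<^sup>2 / 2"
      unfolding g using zero_le_power2[of w] by linarith
    then show ?thesis using 3 by (simp add: g_def)
  qed
  ultimately show ?thesis by (auto simp: \<theta>_def)
qed

text \<open>While \<open>E \<ge> \<delta>\<close>, the function \<open>H\<close> decreases at the rate in the hypothesis \<open>long\<close>. Its total decrease
  is at most \<open>2 * m0\<close>, so the time from \<open>x1\<close> to \<open>X\<close> is too long for \<open>E \<ge> \<delta>\<close> to persist.\<close>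

lemma energy_small_for_long_time:
  assumes X: "exp (2 * X) \<le> 1 / (2 * m1)" and "1 \<le> v"
    and c: "c = 1 / (m0 + 2)" and x1: "v * exp x1 = c" and k: "k = c\<^sup>2 / 64"
    and Xk: "exp (2 * X) \<le> k / (m0 + m1)" and \<delta>: "0 < \<delta>"
    and long: "2 * m0 < k / m0 / (4 + 2 * m0\<^sup>2) / m0 * \<delta> * (X - x1)"
  shows "E X < \<delta>" "0 < R X" "R X < pi"
proof -
  have c0: "0 < c" "c \<le> 1" using m0_ge c by auto
  have k0: "0 < k" using c0 unfolding k by simp
  have k1: "k \<le> 1" using power_le_one[of c 2] c0 k by simp
  have "0 < X - x1"
  proof (rule ccontr)
    assume "\<not> 0 < X - x1"
    then have "k / m0 / (4 + 2 * m0\<^sup>2) / m0 * \<delta> * (X - x1) \<le> 0"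
      using k0 m0_ge \<delta> by (intro mult_nonneg_nonpos) auto
    with long m0_ge show False by linarith
  qed
  then have x1X: "x1 \<le> X" by simp
  note start = state_after_escape[OF X \<open>1 \<le> v\<close> c x1 x1X]
  \<comment> \<open>At the walls \<open>R = 0\<close> and \<open>R = pi\<close> the potential energy alone would be at least \<open>(m0 - k) / 2\<close>,
      more than the available \<open>m0 / 2 - k\<close>.\<close>
  have cos: "(m0 - k) * (cos (R x))\<^sup>2 \<le> m0 - 2 * k" if "x1 \<le> x" "x \<le> X" for x
  proof -
    have "(m0 - k) * (cos (R x))\<^sup>2 \<le> b x * (cos (R x))\<^sup>2"
      using k0 by (intro mult_right_mono b_ge_near_m0 small_exp_mono[OF Xk that(2)]) auto
    also have "\<dots> \<le> 2 * E x" by (simp add: E_def)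
    also have "\<dots> \<le> m0 - 2 * k"
      using E_decreasing[OF X that] start(3) k by simp
    finally show ?thesis .
  qed
  have sin: "k / m0 \<le> (sin (R x))\<^sup>2" if "x1 \<le> x" "x \<le> X" for x
  proof -
    have "k \<le> (m0 - k) * (sin (R x))\<^sup>2"
      using cos[OF that] unfolding cos_squared_eq by (simp add: algebra_simps)
    also have "\<dots> \<le> m0 * (sin (R x))\<^sup>2" using k0 by (intro mult_right_mono) auto
    finally show ?thesis using m0_ge by (simp add: divide_le_eq mult.commute)
  qed
  have "(cos (R x))\<^sup>2 < (cos 0)\<^sup>2" if "x1 \<le> x" "x \<le> X" for x
  proof -
    have "0 < k / m0" using k0 m0_ge by simp
    then have "0 < (sin (R x))\<^sup>2" using sin[OF that] by linarith
    then show ?thesis unfolding cos_squared_eq[of "R x"] by simp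
  qed
  moreover have "R x1 < pi" using start(2) c0 pi_ge_two by linarith
  ultimately show "0 < R X" "R X < pi"
    using well_confinement[of x1 X 0 X] start(1) x1X by auto
  show "E X < \<delta>"
  proof (rule ccontr)
    assume "\<not> E X < \<delta>"
    define g where "g = k / m0 / (4 + 2 * m0\<^sup>2) / m0 * \<delta>"
    have "H X + g * X \<le> H x1 + g * x1"
    proof (rule DERIV_nonpos_imp_nonincreasing[where f = "\<lambda>x. H x + g * x", OF x1X])
      fix x assume x: "x1 \<le> x" "x \<le> X"
      have "\<delta> \<le> E x" using E_decreasing[OF X x(2)] \<open>\<not> E X < \<delta>\<close> by simp
      then obtain D where D: "(H has_real_derivative D) (at x)" "D \<le> - g"
        using H_deriv_le[OF small_exp_mono[OF X x(2)] sin[OF x]] k0 k1 m0_ge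
        by (auto simp: g_def)
      have "((\<lambda>x. H x + g * x) has_real_derivative D + g) (at x)"
        by (rule derivative_eq_intros D(1) refl | simp)+
      with D(2) show "\<exists>y. ((\<lambda>x. H x + g * x) has_real_derivative y) (at x) \<and> y \<le> 0"
        by force
    qed
    then have "g * (X - x1) \<le> H x1 - H X" by (simp add: algebra_simps)
    also have "\<dots> \<le> 2 * m0"
      using abs_H_le[OF X] abs_H_le[OF small_exp_mono[OF X x1X]] by linarith
    finally show False using long by (simp add: g_def)
  qed
qed

section \<open>Later times\<close>

text \<open>Unlike \<open>E\<close>, this function stays positive definite around \<open>pi / 2\<close> when \<open>b\<close> changes sign.\<close>

definition F :: "real \<Rightarrow> real" where
  "F x = (W x)\<^sup>2 + (cos (R x))\<^sup>2"

text \<open>Both \<open>a\<close> and \<open>b - 1\<close> have this form.\<close>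

lemma abs_quotient_le:
  fixes A B :: real
  assumes "0 \<le> A" "0 \<le> B"
  shows "\<bar>(A - B * exp (2 * x)) / (1 + exp (2 * x))\<bar> \<le> A + B"
proof -
  have "0 \<le> B * exp (2 * x)" "0 \<le> A * exp (2 * x)" using assms by auto
  then have "\<bar>A - B * exp (2 * x)\<bar> \<le> (A + B) * (1 + exp (2 * x))"
    using assms unfolding distrib_left distrib_right by linarith
  moreover have "\<bar>1 + exp (2 * x)\<bar> = 1 + exp (2 * x)" by (simp add: add_nonneg_nonneg)
  ultimately show ?thesis
    unfolding abs_divide by (simp add: pos_divide_le_eq add_pos_pos)
qed

text \<open>Since \<open>\<bar>sin R * cos R\<bar> \<le> \<bar>cos R\<bar>\<close>, every term of the derivative is quadratic in \<open>W\<close> and \<open>cos R\<close>.\<close>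

lemma F_deriv_le:
  "\<exists>D. (F has_real_derivative D) (at x) \<and> D \<le> 4 * (m0 + m1) * F x"
proof -
  define w y where "w = W x" and "y = sin (R x) * cos (R x)"
  have aM: "\<bar>a x\<bar> \<le> m0 + m1"
    using abs_quotient_le[of "m0 - 1" "m1 - 1" x] m0_ge m1_ge by (simp add: damping_def)
  have "b x - 1 = ((m0 - 1) - (m1 + 1) * exp (2 * x)) / (1 + exp (2 * x))"
    using add_pos_pos[OF zero_less_one exp_gt_zero[of "2 * x"]]
    by (simp add: pull_def divide_simps) (simp add: algebra_simps)
  then have bM: "\<bar>b x - 1\<bar> \<le> m0 + m1"
    using abs_quotient_le[of "m0 - 1" "m1 + 1" x] m0_ge m1_ge by simp
  have "(F has_real_derivative 2 * w * (- a x * w + b x * y) - 2 * y * w) (at x)"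
    unfolding F_def[abs_def] w_def y_def
    by (rule derivative_eq_intros R_deriv W_deriv refl | simp)+
  moreover have "2 * w * (- a x * w + b x * y) - 2 * y * w \<le> 4 * (m0 + m1) * F x"
  proof -
    have "- a x * w\<^sup>2 \<le> (m0 + m1) * w\<^sup>2" using aM by (intro mult_right_mono) auto
    moreover have "2 * ((b x - 1) * (w * y)) \<le> (m0 + m1) * (w\<^sup>2 + (cos (R x))\<^sup>2)"
    proof -
      have "y\<^sup>2 \<le> 1 * (cos (R x))\<^sup>2" unfolding y_def power_mult_distrib
        by (intro mult_right_mono) (auto simp: abs_square_le_1)
      moreover have "0 \<le> (\<bar>w\<bar> - \<bar>y\<bar>)\<^sup>2" by simp
      ultimately have "2 * \<bar>w * y\<bar> \<le> w\<^sup>2 + (cos (R x))\<^sup>2" by (simp add: power2_diff abs_mult)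
      then have "\<bar>b x - 1\<bar> * (2 * \<bar>w * y\<bar>) \<le> (m0 + m1) * (w\<^sup>2 + (cos (R x))\<^sup>2)"
        using bM by (intro mult_mono) auto
      moreover have "(b x - 1) * (w * y) \<le> \<bar>b x - 1\<bar> * \<bar>w * y\<bar>"
        by (metis abs_ge_self abs_mult)
      ultimately show ?thesis by linarith
    qed
    moreover have "0 \<le> (m0 + m1) * w\<^sup>2" "0 \<le> (m0 + m1) * (cos (R x))\<^sup>2"
      using m0_ge m1_ge by auto
    ultimately show ?thesis by (simp add: F_def w_def[symmetric] algebra_simps power2_eq_square[of w])
  qed
  ultimately show ?thesis by blast
qed

lemma F_growth:
  assumes "p \<le> x"
  shows "F x \<le> exp (4 * (m0 + m1) * (x - p)) * F p"
proof -
  define K where "K = 4 * (m0 + m1)"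
  have "exp (- K * x) * F x \<le> exp (- K * p) * F p"
  proof (rule DERIV_nonpos_imp_nonincreasing[where f = "\<lambda>x. exp (- K * x) * F x", OF assms])
    fix t
    obtain D where D: "(F has_real_derivative D) (at t)" "D \<le> K * F t"
      using F_deriv_le unfolding K_def by blast
    have "((\<lambda>x. exp (- K * x) * F x) has_real_derivative exp (- K * t) * (D - K * F t)) (at t)"
      by ((rule derivative_eq_intros D(1) refl | simp)+, simp add: algebra_simps)
    moreover have "exp (- K * t) * (D - K * F t) \<le> 0"
      using D(2) by (intro mult_nonneg_nonpos) auto
    ultimately show "\<exists>y. ((\<lambda>x. exp (- K * x) * F x) has_real_derivative y) (at t) \<and> y \<le> 0"
      by blast
  qed
  then have "exp (K * x) * (exp (- K * x) * F x) \<le> exp (K * x) * (exp (- K * p) * F p)"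
    by (intro mult_left_mono) auto
  then show ?thesis by (simp add: K_def algebra_simps flip: exp_add mult.assoc)
qed

lemma close_to_half_pi:
  assumes X: "exp (2 * X) \<le> 1 / (2 * m1)" and R: "0 < R X" "R X < pi"
    and E: "E X < exp (- (4 * (m0 + m1) * (X1 - X))) * (sin \<epsilon>)\<^sup>2 / 2"
    and \<epsilon>: "0 < \<epsilon>" "\<epsilon> < pi / 2" and x: "X \<le> x" "x \<le> X1"
  shows "\<bar>R x - pi / 2\<bar> < \<epsilon>"
proof -
  have "(cos (R y))\<^sup>2 < (cos (pi / 2 - \<epsilon>))\<^sup>2" if y: "X \<le> y" "y \<le> X1" for y
  proof -
    have "1 * (cos (R X))\<^sup>2 \<le> b X * (cos (R X))\<^sup>2"
      using b_ge_one[OF X] by (intro mult_right_mono) auto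
    then have FE: "F X \<le> 2 * E X" by (simp add: F_def E_def)
    have "(cos (R y))\<^sup>2 \<le> F y" by (simp add: F_def)
    also have "\<dots> \<le> exp (4 * (m0 + m1) * (y - X)) * F X" by (rule F_growth[OF y(1)])
    also have "\<dots> \<le> exp (4 * (m0 + m1) * (X1 - X)) * F X"
      using y m0_ge m1_ge by (intro mult_right_mono) (auto simp: F_def)
    also have "\<dots> < exp (4 * (m0 + m1) * (X1 - X)) *
        (exp (- (4 * (m0 + m1) * (X1 - X))) * (sin \<epsilon>)\<^sup>2)"
      using E FE by (intro mult_strict_left_mono) auto
    also have "\<dots> = (sin \<epsilon>)\<^sup>2" by (simp flip: exp_add mult.assoc)
    finally show ?thesis by (simp add: cos_diff)
  qed
  from well_confinement[OF R this, of X1 x] \<epsilon> x show ?thesis by (auto simp: abs_less_iff)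
qed

end

text \<open>The order of the choices matters: \<open>k\<close> depends on \<open>m0\<close> only, which allows \<open>X\<close> to be fixed, then the
  energy threshold \<open>\<delta>\<close>, and with it the required relaxation time \<open>L\<close>. Only then is \<open>v\<close> chosen, such
  that the escape time \<open>ln (c / v)\<close> precedes \<open>X\<close> by at least \<open>L\<close>.\<close>

lemma close_to_half_pi_for_large_v:
  fixes m0 m1 X0 X1 \<epsilon> :: real
  assumes m: "2 \<le> m0" "m0 \<le> m1" and \<epsilon>: "0 < \<epsilon>" "\<epsilon> < pi / 2"
  shows "\<exists>v0. \<forall>v\<ge>v0. \<forall>R W. pendulum m0 m1 v R W \<longrightarrow>
           (\<forall>x\<in>{X0..X1}. \<bar>R x - pi / 2\<bar> < \<epsilon>)"
proof -
  define c where "c = 1 / (m0 + 2)"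
  define k where "k = c\<^sup>2 / 64"
  have c0: "0 < c" using m by (simp add: c_def)
  have k0: "0 < k" using c0 by (simp add: k_def)
  define K where "K = min (1 / (2 * m1)) (k / (m0 + m1))"
  have "0 < K" using m k0 by (simp add: K_def)
  define X where "X = min X0 (ln K / 2)"
  have "exp (2 * X) \<le> exp (ln K)" unfolding exp_le_cancel_iff by (simp add: X_def)
  then have "exp (2 * X) \<le> K" using \<open>0 < K\<close> by simp
  then have XK: "exp (2 * X) \<le> 1 / (2 * m1)" "exp (2 * X) \<le> k / (m0 + m1)"
    by (simp_all add: K_def)
  define \<delta> where "\<delta> = exp (- (4 * (m0 + m1) * (X1 - X))) * (sin \<epsilon>)\<^sup>2 / 2"
  have "0 < sin \<epsilon>" using \<epsilon> by (intro sin_gt_zero) auto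
  then have \<delta>: "0 < \<delta>" by (simp add: \<delta>_def)
  define g where "g = k / m0 / (4 + 2 * m0\<^sup>2) / m0 * \<delta>"
  have "0 < 4 + 2 * m0\<^sup>2" by (intro add_pos_nonneg) auto
  then have g: "0 < g" using k0 m \<delta> by (simp add: g_def)
  define L where "L = 2 * m0 / g + 1"
  show ?thesis
  proof (intro exI[of _ "max 1 (c * exp (L - X))"] allI impI ballI)
    fix v R W x
    assume v: "max 1 (c * exp (L - X)) \<le> v" and "pendulum m0 m1 v R W" and x: "x \<in> {X0..X1}"
    interpret pendulum m0 m1 v R W by fact
    have v0: "0 < v" using v by simp
    define x1 where "x1 = ln (c / v)"
    have x1: "v * exp x1 = c" using v0 c0 by (simp add: x1_def)
    have "c * exp (L - X) \<le> v" using v by simp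
    then have "ln (c * exp (L - X)) \<le> ln v" using c0 by (subst ln_le_cancel_iff) (auto intro: v0)
    then have "L \<le> X - x1" using c0 v0 by (simp add: x1_def ln_mult ln_div)
    then have "g * L \<le> g * (X - x1)" using g by (intro mult_left_mono) auto
    moreover have "g * L = 2 * m0 + g" using g by (simp add: L_def field_simps)
    ultimately have "2 * m0 < g * (X - x1)" using g by linarith
    then have "E X < \<delta>" "0 < R X" "R X < pi"
      using energy_small_for_long_time[OF XK(1) _ c_def x1 k_def XK(2) \<delta>] v by (auto simp: g_def)
    then show "\<bar>R x - pi / 2\<bar> < \<epsilon>"
      using x by (intro close_to_half_pi[OF XK(1) _ _ _ \<epsilon>, of X1]) (auto simp: \<delta>_def X_def)
  qed
qed

section \<open>Return to the original equation\<close>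

lemma ode_rhs_eq:
  assumes "0 < t" "t < pi / 2"
  shows "ode_rhs m0 m1 t x y = (real m1 * tan t - real m0 / tan t) * y
    + (real m0 / (sin t)\<^sup>2 - real m1 / (cos t)\<^sup>2) * (sin x * cos x)"
proof -
  have p: "0 < sin t" "0 < cos t" using assms by (auto intro: sin_gt_zero cos_gt_zero)
  have "(real m1 - real m0) * (1 / sin (2 * t)) - (real m0 + real m1) * cot (2 * t)
     = ((real m1 - real m0) * ((sin t)\<^sup>2 + (cos t)\<^sup>2) - (real m0 + real m1) * ((cos t)\<^sup>2 - (sin t)\<^sup>2))
        / (2 * sin t * cos t)"
    by (simp add: sin_double cos_double cot_def diff_divide_distrib right_diff_distrib)
  also have "(real m1 - real m0) * ((sin t)\<^sup>2 + (cos t)\<^sup>2)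
      - (real m0 + real m1) * ((cos t)\<^sup>2 - (sin t)\<^sup>2)
     = 2 * (real m1 * (sin t)\<^sup>2 - real m0 * (cos t)\<^sup>2)"
    unfolding left_diff_distrib distrib_left right_diff_distrib distrib_right by simp
  also have "\<dots> / (2 * sin t * cos t) = real m1 * tan t - real m0 / tan t"
    using p by (simp add: tan_def field_simps power2_eq_square)
  finally have friction: "(real m1 - real m0) * (1 / sin (2 * t)) - (real m0 + real m1) * cot (2 * t)
     = real m1 * tan t - real m0 / tan t" .
  show ?thesis
    unfolding ode_rhs_def friction sin_double[of x] by (simp add: left_diff_distrib)
qed

text \<open>The substitution \<open>t = arctan (exp x)\<close>, with \<open>dt / dx = sin t * cos t = exp x / (1 + exp (2 * x))\<close>.\<close>

lemma pendulum_of_ivp: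
  assumes "solves_ivp m0 m1 v r" and m: "2 \<le> m0" "m0 \<le> m1"
  shows "\<exists>W. pendulum (real m0) (real m1) v (\<lambda>x. r (arctan (exp x))) W"
proof -
  obtain r' where
    r: "\<And>t. 0 < t \<Longrightarrow> t < pi / 2 \<Longrightarrow> (r has_real_derivative r' t) (at t)" and
    r': "\<And>t. 0 < t \<Longrightarrow> t < pi / 2 \<Longrightarrow> (r' has_real_derivative ode_rhs m0 m1 t (r t) (r' t)) (at t)"
    using assms(1) unfolding solves_ivp_def solves_ode_def greaterThanLessThan_iff Ball_def by blast
  have r0: "r 0 = 0" "(r has_real_derivative v) (at 0 within {0..<pi/2})"
    using assms(1) unfolding solves_ivp_def by auto
  define \<tau> where "\<tau> = (\<lambda>x::real. arctan (exp x))"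
  define q where "q = (\<lambda>x::real. exp x / (1 + exp (2 * x)))"
  define W where "W = (\<lambda>x. r' (\<tau> x) * q x)"
  have \<tau>: "0 < \<tau> x" "\<tau> x < pi / 2" for x
    using arctan_ubound[of "exp x"] by (simp_all add: \<tau>_def)
  have p: "0 < 1 + exp (2 * x)" for x :: real by (simp add: add_pos_pos)
  have e2: "(exp x)\<^sup>2 = exp (2 * x)" for x :: real by (simp add: exp_double)
  have d\<tau>: "(\<tau> has_real_derivative q x) (at x)" for x
  proof -
    have "((\<lambda>x. arctan (exp x)) has_real_derivative inverse (1 + (exp x)\<^sup>2) * exp x) (at x)"
      by (rule DERIV_chain2[OF DERIV_arctan DERIV_exp])
    then show ?thesis by (simp add: \<tau>_def q_def e2 divide_inverse mult.commute)
  qed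
  have dq: "(q has_real_derivative q x * (1 - exp (2 * x)) / (1 + exp (2 * x))) (at x)" for x
  proof -
    have "(q has_real_derivative (exp x * (1 + exp (2 * x)) - exp x * (2 * exp (2 * x)))
        / ((1 + exp (2 * x)) * (1 + exp (2 * x)))) (at x)"
      unfolding q_def using p[of x]
      by (intro DERIV_divide) (auto intro!: derivative_eq_intros)
    also have "exp x * (1 + exp (2 * x)) - exp x * (2 * exp (2 * x)) = exp x * (1 - exp (2 * x))"
      by (simp add: algebra_simps)
    finally show ?thesis by (simp add: q_def)
  qed
  have tan: "tan (\<tau> x) = exp x" for x by (simp add: \<tau>_def tan_arctan)
  have cos: "(cos (\<tau> x))\<^sup>2 = 1 / (1 + exp (2 * x))" for x
    unfolding \<tau>_def cos_arctan power_divide e2 using p[of x] by simp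
  have sin: "(sin (\<tau> x))\<^sup>2 = exp (2 * x) / (1 + exp (2 * x))" for x
    unfolding \<tau>_def sin_arctan power_divide e2 using p[of x] by simp
  have "pendulum (real m0) (real m1) v (\<lambda>x. r (\<tau> x)) W"
  proof
    show "2 \<le> real m0" "real m0 \<le> real m1" using m by auto
    fix x
    show "((\<lambda>x. r (\<tau> x)) has_real_derivative W x) (at x)"
      unfolding W_def by (rule DERIV_chain2[OF r[OF \<tau>] d\<tau>])
    have "((\<lambda>x. r' (\<tau> x)) has_real_derivative ode_rhs m0 m1 (\<tau> x) (r (\<tau> x)) (r' (\<tau> x)) * q x) (at x)"
      by (rule DERIV_chain2[OF r'[OF \<tau>] d\<tau>])
    from DERIV_mult[OF this dq]
    have "(W has_real_derivative ode_rhs m0 m1 (\<tau> x) (r (\<tau> x)) (r' (\<tau> x)) * q x * q x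
        + q x * (1 - exp (2 * x)) / (1 + exp (2 * x)) * r' (\<tau> x)) (at x)"
      by (simp add: W_def)
    also have "ode_rhs m0 m1 (\<tau> x) (r (\<tau> x)) (r' (\<tau> x)) * q x * q x
        + q x * (1 - exp (2 * x)) / (1 + exp (2 * x)) * r' (\<tau> x)
      = - damping m0 m1 x * W x + pull m0 m1 x * (sin (r (\<tau> x)) * cos (r (\<tau> x)))"
    proof -
      define T where "T = exp x"
      have T: "0 < T" "exp (2 * x) = T\<^sup>2" "0 < 1 + T\<^sup>2"
        by (auto simp: T_def e2 p)
      define y where "y = r' (\<tau> x)"
      define s where "s = sin (r (\<tau> x)) * cos (r (\<tau> x))"
      have regroup: "(A * y + B * s) * q * q + q * G / d * y = (A * q + G / d) * (y * q) + B * q\<^sup>2 * s"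
        for A B q G d :: real
        by (simp add: algebra_simps power2_eq_square)
      have "(real m1 * T - real m0 / T) * (T / (1 + T\<^sup>2)) + (1 - T\<^sup>2) / (1 + T\<^sup>2)
          = - damping m0 m1 x"
      proof -
        have "(real m1 * T - real m0 / T) * T = real m1 * T\<^sup>2 - real m0"
          using T(1) by (simp add: left_diff_distrib power2_eq_square)
        then have "(real m1 * T - real m0 / T) * (T / (1 + T\<^sup>2)) + (1 - T\<^sup>2) / (1 + T\<^sup>2)
            = (real m1 * T\<^sup>2 - real m0 + (1 - T\<^sup>2)) / (1 + T\<^sup>2)"
          by (simp add: add_divide_distrib)
        then show ?thesis
          unfolding damping_def T(2) minus_divide_left by (simp add: algebra_simps)
      qed
      moreover have "(real m0 / (T\<^sup>2 / (1 + T\<^sup>2)) - real m1 / (1 / (1 + T\<^sup>2))) * (T / (1 + T\<^sup>2))\<^sup>2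
          = pull m0 m1 x"
        unfolding pull_def T(2) using T(1,3)
        by (simp add: divide_simps power2_eq_square) (simp add: algebra_simps)
      moreover have "((real m1 * T - real m0 / T) * y +
            (real m0 / (T\<^sup>2 / (1 + T\<^sup>2)) - real m1 / (1 / (1 + T\<^sup>2))) * s)
            * (T / (1 + T\<^sup>2)) * (T / (1 + T\<^sup>2)) + (T / (1 + T\<^sup>2)) * (1 - T\<^sup>2) / (1 + T\<^sup>2) * y
        = ((real m1 * T - real m0 / T) * (T / (1 + T\<^sup>2)) + (1 - T\<^sup>2) / (1 + T\<^sup>2)) * (y * (T / (1 + T\<^sup>2)))
          + (real m0 / (T\<^sup>2 / (1 + T\<^sup>2)) - real m1 / (1 / (1 + T\<^sup>2))) * (T / (1 + T\<^sup>2))\<^sup>2 * s"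
        by (rule regroup)
      ultimately show ?thesis
        unfolding ode_rhs_eq[OF \<tau>] tan cos sin W_def q_def T(2) T_def[symmetric]
          y_def[symmetric] s_def[symmetric] by simp
    qed
    finally show "(W has_real_derivative - damping m0 m1 x * W x
        + pull m0 m1 x * (sin (r (\<tau> x)) * cos (r (\<tau> x)))) (at x)" .
  next
    have lim\<tau>: "filterlim \<tau> (at 0 within {0..<pi/2}) at_bot"
      unfolding filterlim_at
    proof
      show "eventually (\<lambda>x. \<tau> x \<in> {0..<pi/2} \<and> \<tau> x \<noteq> 0) at_bot"
        using \<tau> by (intro always_eventually) (auto simp: less_imp_le less_imp_neq[symmetric])
      have "((\<lambda>x. arctan (exp x)) \<longlongrightarrow> arctan 0) at_bot"
        by (intro tendsto_arctan exp_at_bot)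
      then show "(\<tau> \<longlongrightarrow> 0) at_bot" by (simp add: \<tau>_def)
    qed
    have "((\<lambda>t. r t / t) \<longlongrightarrow> v) (at 0 within {0..<pi/2})"
      using r0 by (simp add: has_field_derivative_iff)
    then have 1: "((\<lambda>x. r (\<tau> x) / \<tau> x) \<longlongrightarrow> v) at_bot"
      by (rule filterlim_compose[OF _ lim\<tau>])
    have "(arctan has_real_derivative 1) (at 0)"
      using DERIV_arctan[of 0] by simp
    then have "((\<lambda>h. arctan h / h) \<longlongrightarrow> 1) (at 0)"
      by (simp add: has_field_derivative_iff)
    moreover have "filterlim exp (at (0::real)) at_bot"
      unfolding filterlim_at by (auto intro: exp_at_bot)
    ultimately have 2: "((\<lambda>x. \<tau> x / exp x) \<longlongrightarrow> 1) at_bot"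
      unfolding \<tau>_def by (rule filterlim_compose)
    have "((\<lambda>x. r (\<tau> x) / \<tau> x * (\<tau> x / exp x)) \<longlongrightarrow> v * 1) at_bot"
      by (intro tendsto_mult 1 2)
    moreover have "r (\<tau> x) / \<tau> x * (\<tau> x / exp x) = r (\<tau> x) / exp x" for x
      using \<tau>(1)[of x] by simp
    ultimately show "((\<lambda>x. r (\<tau> x) / exp x) \<longlongrightarrow> v) at_bot" by simp
  qed
  then show ?thesis unfolding \<tau>_def by blast
qed

theorem theoremD:
  fixes m0 m1 :: nat and t0 t1 \<epsilon> :: real
  assumes "2 \<le> m0" and "m0 \<le> m1"
    and "t0 \<in> {0<..<pi/2}" and "t1 \<in> {0<..<pi/2}" and "0 < \<epsilon>"
  shows "\<exists>v0::real. \<forall>v\<ge>v0. \<forall>r. solves_ivp m0 m1 v r \<longrightarrow>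
           (\<forall>t\<in>{t0<..<t1}. \<bar>r t - pi/2\<bar> < \<epsilon>)"
proof -
  \<comment> \<open>The confinement estimate needs a distance below \<open>pi / 2\<close>.\<close>
  define d where "d = min \<epsilon> (1 / 2)"
  have d: "0 < d" "d < pi / 2" "d \<le> \<epsilon>"
    using \<open>0 < \<epsilon>\<close> pi_ge_two by (auto simp: d_def)
  have "\<exists>v0. \<forall>v\<ge>v0. \<forall>R W. pendulum (real m0) (real m1) v R W \<longrightarrow>
      (\<forall>x\<in>{ln (tan t0)..ln (tan t1)}. \<bar>R x - pi / 2\<bar> < d)"
    using assms d by (intro close_to_half_pi_for_large_v) auto
  then obtain v0 where v0: "\<And>v R W x. v0 \<le> v \<Longrightarrow> pendulum (real m0) (real m1) v R W \<Longrightarrow>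
      x \<in> {ln (tan t0)..ln (tan t1)} \<Longrightarrow> \<bar>R x - pi / 2\<bar> < d"
    by blast
  show ?thesis
  proof (intro exI[of _ v0] allI impI ballI)
    fix v r t
    assume v: "v0 \<le> v" and ivp: "solves_ivp m0 m1 v r" and t: "t \<in> {t0<..<t1}"
    obtain W where W: "pendulum (real m0) (real m1) v (\<lambda>x. r (arctan (exp x))) W"
      using pendulum_of_ivp[OF ivp assms(1,2)] by blast
    have pos: "0 < tan t" "0 < tan t0" "0 < tan t1"
      using assms t by (auto intro: tan_gt_zero)
    have "tan t0 \<le> tan t" "tan t \<le> tan t1"
      using assms t by (auto intro!: tan_mono_le)
    then have "ln (tan t) \<in> {ln (tan t0)..ln (tan t1)}" using pos by simp
    moreover have "arctan (exp (ln (tan t))) = t"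
      using pos assms t by (simp add: arctan_tan)
    ultimately show "\<bar>r t - pi / 2\<bar> < \<epsilon>"
      using v0[OF v W] d(3) by fastforce
  qed
qed

end
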